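(* Let $X$ be a compact $T_1$ space and let $\mathcal{C}$ be a countable family of minimal open covers of $X$ that is coinitial with respect to refinement among all open covers of $X$ (i.e. every open cover of $X$ is refined by some member of $\mathcal{C}$). Then there is a level-injective $\omega$-cap-basis $\mathbb{P}$ of $X$ all of whose levels $\mathbb{P}_n$, $n\in\omega$, belong to $\mathcal{C}$ (that is, $\mathcal{C}$ has a subfamily that forms the levels of a level-injective $\omega$-cap-basis).
   Context: A cover is minimal if no proper subfamily is a cover. A cover $A$ refines a cover $B$ if every $a\in A$ is contained in some $b\in B$. Let $(\mathbb{P},\leq)$ be a poset. A subset $S\subseteq\mathbb{P}$ refines $T\subseteq\mathbb{P}$ if for every $s\in S$ there is $t\in T$ with $s\leq t$. A band of $\mathbb{P}$ is a finite subset $B\subseteq\mathbb{P}$ such that every $p\in\mathbb{P}$ is comparable to some $b\in B$. A cap of $\mathbb{P}$ is a subset refined by some band. $\mathbb{P}$ is an $\omega$-poset if every principal filter $p^\leq=\{q\in\mathbb{P}:p\leq q\}$ is finite and, for each $n\in\omega$, the number of principal filters of size $n$ is finite. In an $\omega$-poset the rank of $p$ is $\mathsf{r}(p)=\sup_{q>p}(\mathsf{r}(q)+1)$ (a finite number, equal to $0$ for maximal elements); for $n\in\omega$ the $n$th cone is $\mathbb{P}^n=\{p\in\mathbb{P}:\mathsf{r}(p)\leq n\}$ and the $n$th level $\mathbb{P}_n$ is the set of minimal elements of $\mathbb{P}^n$. An $\omega$-poset is level-injective if each level $\mathbb{P}_n$ is a minimal cap (i.e. a cap no proper subset of which is a cap).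 A basis $\mathbb{P}$ of a topological space $X$, ordered by inclusion, is a cap-basis if for all $C\subseteq\mathbb{P}$, $C$ is a cap of $\mathbb{P}$ if and only if $X=\bigcup C$. It is an $\omega$-cap-basis if it is a cap-basis and also an $\omega$-poset with respect to inclusion. *)

theory Defs
  imports "HOL-Analysis.Analysis"
begin

text \<open>A poset is a subset \<open>P\<close> of a type of class \<open>order\<close>, with the order restricted to \<open>P\<close>. Families
  of sets are the instance in which the order is inclusion.\<close>

definition poset_refines :: "'p::order set \<Rightarrow> 'p set \<Rightarrow> bool" where
  "poset_refines S T \<longleftrightarrow> (\<forall>s\<in>S. \<exists>t\<in>T. s \<le> t)"

definition band :: "'p::order set \<Rightarrow> 'p set \<Rightarrow> bool" where
  "band P B \<longleftrightarrow> finite B \<and> B \<subseteq> P \<and> (\<forall>p\<in>P. \<exists>b\<in>B. p \<le> b \<or> b \<le> p)"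

definition cap :: "'p::order set \<Rightarrow> 'p set \<Rightarrow> bool" where
  "cap P C \<longleftrightarrow> C \<subseteq> P \<and> (\<exists>B. band P B \<and> poset_refines B C)"

definition minimal_cap :: "'p::order set \<Rightarrow> 'p set \<Rightarrow> bool" where
  "minimal_cap P C \<longleftrightarrow> cap P C \<and> (\<forall>D. D \<subset> C \<longrightarrow> \<not> cap P D)"

definition principal_filter :: "'p::order set \<Rightarrow> 'p \<Rightarrow> 'p set" where
  "principal_filter P p = {q\<in>P. p \<le> q}"

definition omega_poset :: "'p::order set \<Rightarrow> bool" where
  "omega_poset P \<longleftrightarrow>
     (\<forall>p\<in>P. finite (principal_filter P p)) \<and>
     (\<forall>n. finite {F \<in> principal_filter P ` P. card F = n})"

text \<open>The guard only serves to make the recursion terminate: ranks are used for elements of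
  \<open>\<omega>\<close>-posets only. There the supremum is over a finite set of naturals, and the supremum of the
  empty set is \<open>0\<close>.\<close>

function poset_rank :: "'p::order set \<Rightarrow> 'p \<Rightarrow> nat" where
  "poset_rank P p =
     (if omega_poset P \<and> p \<in> P then (SUP q\<in>{q\<in>P. p < q}. poset_rank P q + 1) else 0)"
  by pat_completeness auto
termination
proof (relation "Wellfounded.measure (\<lambda>(P, p). card (principal_filter P p))")
  fix P :: "'p::order set" and p q
  assume P: "omega_poset P \<and> p \<in> P" and q: "q \<in> {q\<in>P. p < q}"
  have "principal_filter P q \<subseteq> principal_filter P p"
    using q by (auto simp: principal_filter_def)
  moreover have "p \<in> principal_filter P p" "p \<notin> principal_filter P q"
    using P q by (auto simp: principal_filter_def)
  moreover have "finite (principal_filter P p)"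
    using P by (simp add: omega_poset_def)
  ultimately show "((P, q), (P, p)) \<in> Wellfounded.measure (\<lambda>(P, p). card (principal_filter P p))"
    by (auto intro!: psubset_card_mono)
qed simp

declare poset_rank.simps [simp del]

definition rank_cone :: "'p::order set \<Rightarrow> nat \<Rightarrow> 'p set" where
  "rank_cone P n = {p\<in>P. poset_rank P p \<le> n}"

definition level :: "'p::order set \<Rightarrow> nat \<Rightarrow> 'p set" where
  "level P n = {p \<in> rank_cone P n. \<forall>q \<in> rank_cone P n. \<not> q < p}"

definition level_injective :: "'p::order set \<Rightarrow> bool" where
  "level_injective P \<longleftrightarrow> omega_poset P \<and> (\<forall>n. minimal_cap P (level P n))"

definition open_cover :: "'a topology \<Rightarrow> 'a set set \<Rightarrow> bool" where
  "open_cover X A \<longleftrightarrow> (\<forall>a\<in>A. openin X a) \<and> \<Union>A = topspace X"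

definition minimal_open_cover :: "'a topology \<Rightarrow> 'a set set \<Rightarrow> bool" where
  "minimal_open_cover X A \<longleftrightarrow> open_cover X A \<and> (\<forall>B. B \<subset> A \<longrightarrow> \<not> open_cover X B)"

definition basis_of :: "'a topology \<Rightarrow> 'a set set \<Rightarrow> bool" where
  "basis_of X P \<longleftrightarrow>
     (\<forall>V\<in>P. openin X V) \<and> (\<forall>U x. openin X U \<and> x \<in> U \<longrightarrow> (\<exists>V\<in>P. x \<in> V \<and> V \<subseteq> U))"

definition cap_basis :: "'a topology \<Rightarrow> 'a set set \<Rightarrow> bool" where
  "cap_basis X P \<longleftrightarrow> basis_of X P \<and> (\<forall>C. C \<subseteq> P \<longrightarrow> (cap P C \<longleftrightarrow> topspace X = \<Union>C))"

definition omega_cap_basis :: "'a topology \<Rightarrow> 'a set set \<Rightarrow> bool" where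
  "omega_cap_basis X P \<longleftrightarrow> cap_basis X P \<and> omega_poset P"

end

theory Submission
  imports Defs
begin

text \<open>
  A sequence of covers \<open>L 0, L 1, \<dots>\<close> is selected from the given family so that each cover refines
  its predecessor, every open cover is refined by some \<open>L n\<close>, and moreover the refinement is
  strict wherever this is possible: a member of \<open>L n\<close> can lie inside a member of \<open>L (n + 1)\<close> only
  if it is a singleton. Strictness can be had because \<open>X\<close> is compact and \<open>T\<^sub>1\<close>. As \<open>L n\<close> is finite, there is a finite
  set \<open>F\<close> meeting each of its non-singleton members at least twice, and the sets \<open>X - (F - {x})\<close>,
  each of which meets \<open>F\<close> at most once, form an open cover; any cover refining it has no member
  that includes a non-singleton member of \<open>L n\<close> (lemma \<open>strictly_refining_cover\<close>).

  Let \<open>P\<close> be the union of the \<open>L n\<close>. The members of a minimal cover are pairwise incomparable, so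
  strict inclusion in \<open>P\<close> can only go from a later cover to an earlier one. Strictness
  makes the levels come out right: if \<open>p\<close> first occurs in \<open>L (n + 1)\<close> then it lies properly inside
  some \<open>q\<close> in \<open>L n\<close>, this \<open>q\<close> is not a singleton, and hence \<open>q\<close> itself first occurs in \<open>L n\<close>.
  Inductively, the rank of \<open>p\<close> is the index of the first cover containing it (lemma
  \<open>poset_rank_eq\<close>). A member of \<open>L k\<close> contains a point that no other member of \<open>L k\<close> contains, so it
  includes a member of every later cover; together these facts identify \<open>L n\<close> with
  the \<open>n\<close>th level of \<open>P\<close> (lemma \<open>level_eq\<close>).

  That caps are exactly the covers also has two sides. A cover by members of \<open>P\<close> is refined by some
  \<open>L n\<close>, and each \<open>L n\<close> is a band. Conversely, a band must cover \<open>X\<close>: if it missed \<open>x\<close>, then a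
  basic neighbourhood of \<open>x\<close> avoiding one point from each of the finitely many elements of the
  band would be incomparable with all of them (lemma \<open>band_covers\<close>).
\<close>

section \<open>Minimal open covers\<close>

lemma poset_refines_trans:
  "poset_refines A B \<Longrightarrow> poset_refines B C \<Longrightarrow> poset_refines A C"
  unfolding poset_refines_def by (meson order_trans)

lemma minimal_open_cover_private_point:
  assumes "minimal_open_cover X A" and a: "a \<in> A"
  obtains x where "x \<in> a" and "\<And>b. b \<in> A \<Longrightarrow> x \<in> b \<Longrightarrow> b = a"
proof -
  have A: "open_cover X A" and "\<not> open_cover X (A - {a})"
    using assms unfolding minimal_open_cover_def by blast+
  then have "\<Union>(A - {a}) \<noteq> \<Union>A"
    unfolding open_cover_def by auto
  then show thesis
    using that by blast
qed

lemma minimal_open_cover_nonempty: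
  "minimal_open_cover X A \<Longrightarrow> a \<in> A \<Longrightarrow> a \<noteq> {}"
  by (metis empty_iff minimal_open_cover_private_point)

lemma minimal_open_cover_antichain:
  "minimal_open_cover X A \<Longrightarrow> a \<in> A \<Longrightarrow> b \<in> A \<Longrightarrow> a \<subseteq> b \<Longrightarrow> a = b"
  by (metis minimal_open_cover_private_point subsetD)

lemma minimal_open_cover_finite:
  assumes "compact_space X" and A: "minimal_open_cover X A"
  shows "finite A"
proof -
  have "open_cover X A"
    using A by (simp add: minimal_open_cover_def)
  then obtain F where F: "finite F" "F \<subseteq> A" "topspace X \<subseteq> \<Union>F"
    using assms(1) unfolding compact_space_alt open_cover_def by (metis order_refl)
  then have "open_cover X F"
    using \<open>open_cover X A\<close> unfolding open_cover_def by blast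
  then have "F = A"
    using A F unfolding minimal_open_cover_def by blast
  then show ?thesis
    using F by simp
qed

lemma open_cover_Int:
  assumes "open_cover X A" and "open_cover X B"
  shows "open_cover X {a \<inter> b |a b. a \<in> A \<and> b \<in> B}"
proof -
  have "\<Union>{a \<inter> b |a b. a \<in> A \<and> b \<in> B} = \<Union>A \<inter> \<Union>B"
    by blast
  then show ?thesis
    using assms unfolding open_cover_def by auto
qed

lemma t1_openin_remove_finite:
  assumes "t1_space X" and "finite F"
  shows "openin X (topspace X - F)"
proof -
  have "closedin X (topspace X \<inter> F)"
    using assms t1_space_closedin_finite by (metis Int_lower1 finite_Int)
  then have "openin X (topspace X - (topspace X \<inter> F))"
    by blast
  then show ?thesis
    by (simp add: Diff_Int_distrib Diff_Int)
qed

text \<open>The members of the cover \<open>W\<close> below each contain at most one point of \<open>F\<close>, whereas every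
  non-singleton member of \<open>A\<close> contains at least two.\<close>

lemma strictly_refining_cover:
  assumes "compact_space X" and T1: "t1_space X" and A: "minimal_open_cover X A"
  shows "\<exists>W. open_cover X W \<and> (\<forall>a\<in>A. \<forall>w\<in>W. a \<subseteq> w \<longrightarrow> is_singleton a)"
proof -
  have "\<exists>y z. y \<in> a \<and> z \<in> a \<and> y \<noteq> z" if "a \<in> A" "\<not> is_singleton a" for a
    using minimal_open_cover_nonempty[OF A that(1)] that(2)
    by (metis ex_in_conv is_singletonI')
  then obtain y z where yz:
    "\<And>a. a \<in> A \<Longrightarrow> \<not> is_singleton a \<Longrightarrow> y a \<in> a \<and> z a \<in> a \<and> y a \<noteq> z a"
    by metis
  define F where "F = y ` A \<union> z ` A"
  define W where "W = (\<lambda>x. topspace X - (F - {x})) ` topspace X"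
  have "finite F"
    using minimal_open_cover_finite[OF assms(1) A] by (simp add: F_def)
  then have "open_cover X W"
    using t1_openin_remove_finite[OF T1] unfolding open_cover_def W_def by auto
  moreover have "is_singleton a" if "a \<in> A" "w \<in> W" "a \<subseteq> w" for a w
  proof (rule ccontr)
    assume "\<not> is_singleton a"
    then have "y a \<in> w \<inter> F" "z a \<in> w \<inter> F" "y a \<noteq> z a"
      using yz that unfolding F_def by blast+
    then show False
      using \<open>w \<in> W\<close> unfolding W_def by auto
  qed
  ultimately show ?thesis
    by blast
qed

section \<open>Strictly refining sequences of minimal covers\<close>

locale strictly_refining_sequence =
  fixes X :: "'a topology" and L :: "nat \<Rightarrow> 'a set set"
  assumes t1: "t1_space X"
    and minimal: "minimal_open_cover X (L n)"
    and finite_L: "finite (L n)"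
    and refines_Suc: "poset_refines (L (Suc n)) (L n)"
    and strict: "a \<in> L n \<Longrightarrow> b \<in> L (Suc n) \<Longrightarrow> a \<subseteq> b \<Longrightarrow> is_singleton a"
    and coinitial: "open_cover X B \<Longrightarrow> \<exists>n. poset_refines (L n) B"
begin

definition P :: "'a set set" where
  "P = (\<Union>n. L n)"

lemma L_subset_P: "L n \<subseteq> P"
  by (auto simp: P_def)

lemma Union_L: "\<Union>(L n) = topspace X"
  using minimal by (simp add: minimal_open_cover_def open_cover_def)

lemma openin_P: "p \<in> P \<Longrightarrow> openin X p"
  using minimal unfolding P_def minimal_open_cover_def open_cover_def by blast

lemma nonempty_P: "p \<in> P \<Longrightarrow> p \<noteq> {}"
  using minimal_open_cover_nonempty minimal unfolding P_def by blast

lemma refines_mono: "m \<le> n \<Longrightarrow> poset_refines (L n) (L m)"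
proof (induction n rule: dec_induct)
  case base
  show ?case
    by (auto simp: poset_refines_def)
next
  case (step n)
  then show ?case
    using poset_refines_trans refines_Suc by blast
qed

lemma superset_in_earlier:
  assumes "p \<in> L n" and "m \<le> n"
  obtains q where "q \<in> L m" and "p \<subseteq> q"
  using refines_mono[OF assms(2)] assms(1) unfolding poset_refines_def by blast

text \<open>A later set around a private point of \<open>p\<close> has nowhere else to go than into \<open>p\<close>.\<close>

lemma subset_in_later:
  assumes "p \<in> L m" and "m \<le> n"
  obtains q where "q \<in> L n" and "q \<subseteq> p"
proof -
  obtain x where x: "x \<in> p" "\<And>b. b \<in> L m \<Longrightarrow> x \<in> b \<Longrightarrow> b = p"
    using minimal_open_cover_private_point[OF minimal assms(1)] by blast
  then obtain q where "q \<in> L n" "x \<in> q"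
    using assms(1) Union_L[of m] Union_L[of n] by blast
  then show thesis
    using that x superset_in_earlier[OF _ assms(2)] by (metis subsetD)
qed

lemma psubset_imp_later:
  assumes "p \<in> L m" and "q \<in> L n" and "p \<subset> q"
  shows "n < m"
proof (rule ccontr)
  assume "\<not> n < m"
  then obtain r where "r \<in> L m" "q \<subseteq> r"
    using superset_in_earlier assms(2) by (metis not_less)
  then show False
    using minimal_open_cover_antichain[OF minimal assms(1)] assms(3) by blast
qed

lemma nonsingleton_index_unique:
  assumes "p \<in> L m" and "p \<in> L n" and "\<not> is_singleton p"
  shows "m = n"
proof -
  have "\<not> i < j" if "p \<in> L i" "p \<in> L j" for i j
    using superset_in_earlier[OF that(2), of "Suc i"] strict[OF that(1)] assms(3)
    by (metis Suc_leI)
  then show ?thesis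
    using assms by (metis linorder_neqE_nat)
qed

section \<open>Ranks and levels of the union\<close>

definition first_index :: "'a set \<Rightarrow> nat" where
  "first_index p = (LEAST n. p \<in> L n)"

lemma first_index_mem: "p \<in> P \<Longrightarrow> p \<in> L (first_index p)"
  unfolding first_index_def P_def by (auto intro: LeastI)

lemma first_index_le: "p \<in> L n \<Longrightarrow> first_index p \<le> n"
  unfolding first_index_def by (rule Least_le)

lemma first_index_psubset:
  "p \<in> P \<Longrightarrow> q \<in> P \<Longrightarrow> p \<subset> q \<Longrightarrow> first_index q < first_index p"
  using psubset_imp_later first_index_mem by blast

text \<open>A set properly including a nonempty set is not a singleton, so it occurs in just one of the
  covers. This is what prevents the ranks from lagging behind the indices.\<close>

lemma first_index_predecessor:
  assumes p: "p \<in> P" and n: "first_index p = Suc n"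
  obtains q where "q \<in> P" and "p \<subset> q" and "first_index q = n"
proof -
  obtain q where q: "q \<in> L n" "p \<subseteq> q"
    using superset_in_earlier[OF first_index_mem[OF p], of n] n by auto
  have "p \<noteq> q"
    using first_index_le q n by force
  then have "p \<subset> q"
    using q by blast
  then have "\<not> is_singleton q"
    using nonempty_P[OF p] unfolding is_singleton_def by blast
  moreover have "q \<in> P"
    using q L_subset_P by blast
  ultimately have "first_index q = n"
    using nonsingleton_index_unique first_index_mem q by blast
  then show thesis
    using that \<open>q \<in> P\<close> \<open>p \<subset> q\<close> by blast
qed

lemma finite_first_index_le: "finite {p \<in> P. first_index p \<le> n}"
proof -
  have "{p \<in> P. first_index p \<le> n} \<subseteq> (\<Union>k\<le>n. L k)"
    using first_index_mem by blast
  then show ?thesis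
    using finite_L by (meson finite_UN_I finite_atMost finite_subset)
qed

lemma finite_principal_filter_P: "p \<in> P \<Longrightarrow> finite (principal_filter P p)"
proof -
  assume p: "p \<in> P"
  have "first_index q \<le> first_index p" if "q \<in> P" "p \<subseteq> q" for q
    using first_index_psubset[OF p that(1)] that(2) by (cases "p = q") (auto simp: psubset_eq)
  then have "principal_filter P p \<subseteq> {q \<in> P. first_index q \<le> first_index p}"
    unfolding principal_filter_def by blast
  then show ?thesis
    using finite_first_index_le finite_subset by blast
qed

text \<open>Climbing from \<open>p\<close> one index at a time passes through \<open>first_index p\<close> proper supersets. Hence a
  filter of size \<open>n\<close> comes from one of the finitely many sets occurring in the first \<open>n\<close> covers.\<close>

lemma first_index_less_card_filter:
  "p \<in> P \<Longrightarrow> first_index p < card (principal_filter P p)"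
proof (induction "first_index p" arbitrary: p)
  case 0
  then have "p \<in> principal_filter P p"
    by (simp add: principal_filter_def)
  then show ?case
    using 0 finite_principal_filter_P by (metis card_gt_0_iff empty_iff)
next
  case (Suc n)
  obtain q where q: "q \<in> P" "p \<subset> q" "first_index q = n"
    using first_index_predecessor Suc by metis
  have "principal_filter P q \<subset> principal_filter P p"
    using q Suc.prems unfolding principal_filter_def by auto
  then have "card (principal_filter P q) < card (principal_filter P p)"
    by (simp add: Suc.prems finite_principal_filter_P psubset_card_mono)
  then show ?case
    using Suc.hyps q by fastforce
qed

lemma omega_poset_P: "omega_poset P"
proof -
  have "finite {F \<in> principal_filter P ` P. card F = n}" for n
  proof -
    have "{F \<in> principal_filter P ` P. card F = n}
        \<subseteq> principal_filter P ` {p \<in> P. first_index p \<le> n}"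
    proof
      fix F assume "F \<in> {F \<in> principal_filter P ` P. card F = n}"
      then obtain p where "p \<in> P" "F = principal_filter P p" "card F = n"
        by blast
      moreover from this have "first_index p \<le> n"
        using first_index_less_card_filter[of p] by simp
      ultimately show "F \<in> principal_filter P ` {p \<in> P. first_index p \<le> n}"
        by blast
    qed
    then show ?thesis
      using finite_first_index_le finite_surj by blast
  qed
  then show ?thesis
    using finite_principal_filter_P by (simp add: omega_poset_def)
qed

lemma poset_rank_eq: "p \<in> P \<Longrightarrow> poset_rank P p = first_index p"
proof (induction "first_index p" arbitrary: p rule: less_induct)
  case less
  let ?Q = "{q \<in> P. p < q}"
  have "poset_rank P p = (SUP q\<in>?Q. poset_rank P q + 1)"
    using less.prems omega_poset_P by (simp add: poset_rank.simps[of P p])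
  also have "\<dots> = (SUP q\<in>?Q. first_index q + 1)"
    using less first_index_psubset by (intro SUP_cong) auto
  also have "\<dots> = first_index p"
  proof (cases "first_index p")
    case 0
    then have "?Q = {}"
      using first_index_psubset[OF less.prems] by auto
    then show ?thesis
      unfolding \<open>?Q = {}\<close> using 0 by (simp add: Sup_nat_def)
  next
    case (Suc n)
    obtain r where "r \<in> P" "p \<subset> r" "first_index r = n"
      using first_index_predecessor[OF less.prems Suc] .
    then have "first_index p \<in> (\<lambda>q. first_index q + 1) ` ?Q"
      using Suc by force
    moreover have "k \<le> first_index p" if "k \<in> (\<lambda>q. first_index q + 1) ` ?Q" for k
      using that first_index_psubset[OF less.prems] by fastforce
    ultimately show ?thesis
      by (rule cSup_eq_maximum)
  qed
  finally show ?case .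
qed

lemma rank_cone_eq: "rank_cone P n = (\<Union>k\<le>n. L k)"
proof -
  have "rank_cone P n = {p \<in> P. first_index p \<le> n}"
    using poset_rank_eq by (auto simp: rank_cone_def)
  also have "\<dots> = (\<Union>k\<le>n. L k)"
    using first_index_mem first_index_le order_trans L_subset_P by fastforce
  finally show ?thesis .
qed

text \<open>An element of the cone outside \<open>L n\<close> is never minimal there, as it includes a member of \<open>L n\<close>.\<close>

lemma level_eq: "level P n = L n"
proof (intro equalityI subsetI)
  fix p assume "p \<in> level P n"
  then obtain k where k: "k \<le> n" "p \<in> L k" and min: "\<forall>q \<in> \<Union>k\<le>n. L k. \<not> q \<subset> p"
    unfolding level_def rank_cone_eq by blast
  obtain q where "q \<in> L n" "q \<subseteq> p"
    using subset_in_later k by metis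
  then show "p \<in> L n"
    using min by blast
next
  fix p assume "p \<in> L n"
  then have "\<not> q \<subset> p" if "k \<le> n" "q \<in> L k" for k q
    using psubset_imp_later that by (metis not_less)
  then show "p \<in> level P n"
    using \<open>p \<in> L n\<close> unfolding level_def rank_cone_eq by blast
qed

section \<open>Caps of the union are covers\<close>

lemma basis_of_P: "basis_of X P"
proof -
  have "\<exists>V\<in>P. x \<in> V \<and> V \<subseteq> U" if U: "openin X U" "x \<in> U" for U x
  proof -
    have "x \<in> topspace X"
      using U openin_subset by blast
    \<comment> \<open>A set around \<open>x\<close> from a refinement of this cover must lie in \<open>U\<close>.\<close>
    have "open_cover X {U, topspace X - {x}}"
      using U openin_subset[OF U(1)] t1_openin_remove_finite[OF t1, of "{x}"]
      unfolding open_cover_def by auto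
    then obtain n where n: "poset_refines (L n) {U, topspace X - {x}}"
      using coinitial by blast
    obtain V where V: "V \<in> L n" "x \<in> V"
      using Union_L \<open>x \<in> topspace X\<close> by blast
    then have "V \<subseteq> U"
      using n unfolding poset_refines_def by blast
    then show ?thesis
      using V L_subset_P by blast
  qed
  then show ?thesis
    using openin_P unfolding basis_of_def by blast
qed

lemma band_L: "band P (L n)"
proof -
  have "\<exists>b\<in>L n. p \<subseteq> b \<or> b \<subseteq> p" if "p \<in> P" for p
    using that superset_in_earlier subset_in_later unfolding P_def
    by (metis UN_E nat_le_linear)
  then show ?thesis
    using finite_L L_subset_P by (simp add: band_def)
qed

text \<open>A basic set around a missed point \<open>x\<close> lies in no element of the band because of \<open>x\<close>, and
  includes none if it is chosen to avoid the points \<open>y b\<close> below. As the band is finite and \<open>X\<close>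
  is \<open>T\<^sub>1\<close>, such a set exists.\<close>

lemma band_covers:
  assumes B: "band P B"
  shows "topspace X \<subseteq> \<Union>B"
proof (rule ccontr)
  assume "\<not> topspace X \<subseteq> \<Union>B"
  then obtain x where x: "x \<in> topspace X" "x \<notin> \<Union>B"
    by blast
  have "B \<subseteq> P"
    using B by (simp add: band_def)
  then have "\<exists>y. y \<in> b" if "b \<in> B" for b
    using nonempty_P[of b] that by auto
  then obtain y where y: "\<And>b. b \<in> B \<Longrightarrow> y b \<in> b"
    by metis
  have "openin X (topspace X - y ` B)"
    using B t1_openin_remove_finite[OF t1] by (simp add: band_def)
  moreover have "x \<in> topspace X - y ` B"
    using x y by blast
  ultimately obtain p where p: "p \<in> P" "x \<in> p" "p \<subseteq> topspace X - y ` B"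
    using basis_of_P unfolding basis_of_def by meson
  then obtain b where "b \<in> B" "p \<subseteq> b \<or> b \<subseteq> p"
    using B unfolding band_def by blast
  then show False
    using p x y by blast
qed

lemma cap_iff_cover:
  assumes "C \<subseteq> P"
  shows "cap P C \<longleftrightarrow> topspace X = \<Union>C"
proof
  assume "cap P C"
  then obtain B where B: "band P B" "poset_refines B C"
    unfolding cap_def by blast
  have "\<Union>B \<subseteq> \<Union>C"
    using B(2) unfolding poset_refines_def by (meson Sup_mono)
  then have "topspace X \<subseteq> \<Union>C"
    using band_covers[OF B(1)] by (rule order_trans[rotated])
  moreover have "\<Union>C \<subseteq> topspace X"
  proof (rule Sup_least)
    fix c assume "c \<in> C"
    then have "openin X c"
      using assms openin_P by auto
    then show "c \<subseteq> topspace X"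
      by (rule openin_subset)
  qed
  ultimately show "topspace X = \<Union>C"
    by (rule subset_antisym)
next
  assume "topspace X = \<Union>C"
  moreover have "\<forall>c\<in>C. openin X c"
    using assms openin_P by auto
  ultimately have "open_cover X C"
    by (simp add: open_cover_def)
  then obtain n where "poset_refines (L n) C"
    using coinitial by blast
  then show "cap P C"
    using assms band_L[of n] unfolding cap_def by blast
qed

lemma omega_cap_basis_P: "omega_cap_basis X P"
  unfolding omega_cap_basis_def cap_basis_def
  by (intro conjI allI impI basis_of_P cap_iff_cover omega_poset_P)

lemma level_injective_P: "level_injective P"
proof -
  have "minimal_cap P (L n)" for n
  proof -
    have "\<not> cap P D" if "D \<subset> L n" for D
    proof -
      have "D \<subseteq> P"
        using that L_subset_P by blast
      moreover have "\<not> open_cover X D"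
        using that minimal by (auto simp: minimal_open_cover_def)
      ultimately show ?thesis
        using cap_iff_cover[of D] openin_P by (auto simp: open_cover_def)
    qed
    then show ?thesis
      using cap_iff_cover[OF L_subset_P] Union_L by (simp add: minimal_cap_def)
  qed
  then show ?thesis
    using omega_poset_P by (simp add: level_injective_def level_eq)
qed

end

section \<open>Selecting the sequence\<close>

theorem proposition1p23:
  fixes X :: "'a topology" and \<C> :: "'a set set set"
  assumes "compact_space X"
    and "t1_space X"
    and "countable \<C>"
    and "\<And>A. A \<in> \<C> \<Longrightarrow> minimal_open_cover X A"
    and "\<And>B. open_cover X B \<Longrightarrow> \<exists>A\<in>\<C>. poset_refines A B"
  shows "\<exists>P. omega_cap_basis X P \<and> level_injective P \<and> (\<forall>n. level P n \<in> \<C>)"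
proof -
  have cover: "open_cover X A" if "A \<in> \<C>" for A
    using assms(4)[OF that] by (simp add: minimal_open_cover_def)
  have "open_cover X {topspace X}"
    by (simp add: open_cover_def)
  then obtain A0 where "A0 \<in> \<C>"
    using assms(5) by blast
  define E where "E = from_nat_into \<C>"
  have range_E: "range E = \<C>"
    unfolding E_def using \<open>A0 \<in> \<C>\<close> assms(3) by (intro range_from_nat_into) auto
  \<comment> \<open>Refining the \<open>n\<close>th term of an enumeration of the family at step \<open>n\<close> makes the sequence coinitial.\<close>
  define next_cover where
    "next_cover n A B \<longleftrightarrow> poset_refines B A \<and> poset_refines B (E n) \<and>
      (\<forall>a\<in>A. \<forall>b\<in>B. a \<subseteq> b \<longrightarrow> is_singleton a)" for n A B
  have step: "\<exists>B. B \<in> \<C> \<and> next_cover n A B" if A: "A \<in> \<C>" for A n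
  proof -
    obtain W where W: "open_cover X W" "\<forall>a\<in>A. \<forall>w\<in>W. a \<subseteq> w \<longrightarrow> is_singleton a"
      using strictly_refining_cover[OF assms(1,2) assms(4)[OF A]] by blast
    define V where "V = {a \<inter> e |a e. a \<in> A \<and> e \<in> E n}"
    have "E n \<in> \<C>"
      using range_E by blast
    then have "open_cover X {v \<inter> w |v w. v \<in> V \<and> w \<in> W}"
      unfolding V_def using A by (intro open_cover_Int cover W(1))
    then obtain B where B: "B \<in> \<C>" "poset_refines B {v \<inter> w |v w. v \<in> V \<and> w \<in> W}"
      using assms(5) by blast
    have "\<exists>a\<in>A. \<exists>e\<in>E n. \<exists>w\<in>W. b \<subseteq> a \<inter> e \<inter> w" if b: "b \<in> B" for b
    proof -
      obtain c where "c \<in> {v \<inter> w |v w. v \<in> V \<and> w \<in> W}" "b \<subseteq> c"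
        using B(2) b unfolding poset_refines_def by meson
      then show ?thesis
        unfolding V_def by auto
    qed
    then have "poset_refines B A" "poset_refines B (E n)" "poset_refines B W"
      unfolding poset_refines_def by (meson le_inf_iff)+
    moreover from this(3) have "\<forall>a\<in>A. \<forall>b\<in>B. a \<subseteq> b \<longrightarrow> is_singleton a"
      using W(2) unfolding poset_refines_def by (meson order_trans)
    ultimately show ?thesis
      using B(1) unfolding next_cover_def by blast
  qed
  have "\<exists>L. \<forall>n. L n \<in> \<C> \<and> next_cover n (L n) (L (Suc n))"
  proof (rule dependent_nat_choice)
    show "\<exists>A. A \<in> \<C>"
      using \<open>A0 \<in> \<C>\<close> ..
    show "\<exists>B. B \<in> \<C> \<and> next_cover n A B" if "A \<in> \<C>" for A n
      using step[OF that] .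
  qed
  then obtain L where L_mem: "\<And>n. L n \<in> \<C>"
      and L_next: "\<And>n. next_cover n (L n) (L (Suc n))"
    by blast
  interpret strictly_refining_sequence X L
  proof
    fix n a b B
    show "t1_space X" "minimal_open_cover X (L n)"
      using assms(2,4) L_mem by auto
    then show "finite (L n)"
      using assms(1) minimal_open_cover_finite by auto
    show "poset_refines (L (Suc n)) (L n)"
      using L_next by (simp add: next_cover_def)
    show "is_singleton a" if "a \<in> L n" "b \<in> L (Suc n)" "a \<subseteq> b"
      using L_next[of n] that by (auto simp: next_cover_def)
    show "\<exists>n. poset_refines (L n) B" if B: "open_cover X B"
    proof -
      obtain A where A: "A \<in> \<C>" "poset_refines A B"
        using assms(5)[OF B] ..
      then obtain n where "A = E n"
        using range_E by auto
      then have "poset_refines (L (Suc n)) A"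
        using L_next by (simp add: next_cover_def)
      then show ?thesis
        using A(2) poset_refines_trans by blast
    qed
  qed
  show ?thesis
    using omega_cap_basis_P level_injective_P level_eq L_mem by auto
qed

end
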